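(* Let $n\ge 1$ and let $Q\subseteq\mathbb{R}^n$ be a lattice polytope containing the origin $\mathbf{0}$ in its interior, with dual polytope $Q^*$. Let $K\subseteq\mathbb{R}^n$ be an $n$-dimensional convex body with barycenter $\mathbf{0}$ such that $K\subseteq Q^*$ and $\mathbf{0}$ is the only lattice point in the interior of $K$. Then \[{\rm vol}(K)\le \frac{(n+1)^n}{n!},\] with equality if and only if $K$ is unimodularly equivalent to $(n+1)\Delta_n$.
   Context: A convex body is a compact convex set. A lattice polytope has all vertices in $\mathbb{Z}^n$. For a polytope $Q$ with $\mathbf{0}$ in its interior, $Q^* := \{x\in\mathbb{R}^n : \langle v,x\rangle \ge -1 \text{ for all vertices } v \text{ of } Q\}$ for a fixed inner product $\langle\cdot,\cdot\rangle$. Two convex bodies are unimodularly equivalent if some affine automorphism of the lattice $\mathbb{Z}^n$ maps one onto the other. $\Delta_n$ is the simplex with vertices $\mathbf{0},e_1,\dots,e_n$, where $e_1,\dots,e_n$ is the standard basis of $\mathbb{Z}^n$. *)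

theory Defs
  imports "HOL-Analysis.Analysis"
begin

definition int_lattice :: "(real ^ 'n) set" where
  "int_lattice = {x. \<forall>i. x $ i \<in> \<int>}"

definition lattice_polytope :: "(real ^ 'n) set \<Rightarrow> bool" where
  "lattice_polytope Q \<longleftrightarrow> polytope Q \<and> {v. v extreme_point_of Q} \<subseteq> int_lattice"

(* The inner product is the standard one: the integer lattice is self-dual with respect to it. *)
definition dual_polytope :: "(real ^ 'n) set \<Rightarrow> (real ^ 'n) set" where
  "dual_polytope Q = {x. \<forall>v. v extreme_point_of Q \<longrightarrow> v \<bullet> x \<ge> -1}"

definition convex_body :: "(real ^ 'n) set \<Rightarrow> bool" where
  "convex_body K \<longleftrightarrow> compact K \<and> convex K"

(* Only meaningful when K has positive volume; otherwise division by zero makes it 0. *)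
definition barycenter :: "(real ^ 'n) set \<Rightarrow> real ^ 'n" where
  "barycenter K = (LINT x:K|lebesgue. x) /\<^sub>R measure lebesgue K"

definition affine_lattice_automorphism :: "(real ^ 'n \<Rightarrow> real ^ 'n) \<Rightarrow> bool" where
  "affine_lattice_automorphism f \<longleftrightarrow>
     (\<exists>g b. linear g \<and> f = (\<lambda>x. g x + b)) \<and> bij_betw f int_lattice int_lattice"

definition unimodularly_equivalent :: "(real ^ 'n) set \<Rightarrow> (real ^ 'n) set \<Rightarrow> bool" where
  "unimodularly_equivalent A B \<longleftrightarrow> (\<exists>f. affine_lattice_automorphism f \<and> f ` A = B)"

definition unit_simplex :: "(real ^ 'n) set" where
  "unit_simplex = convex hull (insert 0 (range (\<lambda>i. axis i 1)))"

end

theory Submission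
  imports Defs
begin

text \<open>
  Linearly independent vertices \<open>v\<^sub>1, \<dots>, v\<^sub>n\<close> of \<open>Q\<close> give an affine map \<open>x \<mapsto> (\<langle>v\<^sub>i, x\<rangle> + 1)\<^sub>i\<close> that sends \<open>K\<close> to
  a body \<open>C\<close> in the positive orthant with barycenter \<open>(1, \<dots>, 1)\<close> and multiplies volumes by an integer \<open>d \<ge> 1\<close>.
  With \<open>W y = n + 1 - (y\<^sub>1 + \<dots> + y\<^sub>n)\<close> the barycenter condition says that the integral of \<open>W\<close> over \<open>C\<close> is the volume
  of \<open>C\<close>. Inside the orthant \<open>W\<close> is nonnegative exactly on the simplex \<open>S = (n + 1) \<Delta>\<^sub>n\<close>, so this integral is at
  most the integral of \<open>W\<close> over \<open>S\<close>, which is the volume of an \<open>(n + 1)\<close>-dimensional simplex, namely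
  \<open>(n + 1)\<^sup>n\<^sup>+\<^sup>1 / (n + 1)! = (n + 1)\<^sup>n / n!\<close>. Equality forces \<open>C = S\<close> and \<open>d = 1\<close>, and \<open>d = 1\<close> means that the
  affine map is unimodular.
\<close>

text \<open>The library's change of variables by determinants requires a well-ordered index type; relabelling the
  coordinates by this ordered copy of a finite type makes it available for arbitrary finite index types.\<close>

typedef 'a wo = "UNIV :: 'a set" ..

instance wo :: (finite) finite
proof
  show "finite (UNIV :: 'a wo set)"
    by (rule finite_imageD[where f = Rep_wo]) (auto simp: inj_on_def Rep_wo_inject)
qed

instantiation wo :: (finite) wellorder
begin

text \<open>The order is pulled back along the injection \<open>to_nat\<close> into the natural
  numbers, which is where its well-foundedness comes from.\<close>

definition "x \<le> y \<longleftrightarrow> to_nat (Rep_wo x) \<le> to_nat (Rep_wo y)"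
definition "x < y \<longleftrightarrow> to_nat (Rep_wo x) < to_nat (Rep_wo y)"

instance
proof
  fix P :: "'a wo \<Rightarrow> bool" and a
  assume step: "\<And>x. (\<And>y. y < x \<Longrightarrow> P y) \<Longrightarrow> P x"
  show "P a"
    by (induction "to_nat (Rep_wo a)" arbitrary: a rule: less_induct)
       (metis step less_wo_def)
qed (auto simp: less_eq_wo_def less_wo_def Rep_wo_inject)

end

section \<open>Integer matrices and linear maps of the integer lattice\<close>

lemma Basis_eq_range_axis: "(Basis :: (real ^ 'n) set) = range (\<lambda>i. axis i 1)"
  by (auto simp: Basis_vec_def)

lemma mem_int_lattice: "x \<in> int_lattice \<longleftrightarrow> (\<forall>i. x $ i \<in> \<int>)"
  by (simp add: int_lattice_def)

lemma det_Ints: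
  assumes "\<And>i j. (A :: real ^ 'n ^ 'n) $ i $ j \<in> \<int>"
  shows "det A \<in> \<int>"
  unfolding det_def using assms by (intro Ints_sum Ints_mult Ints_prod) auto

lemma Ints_matrix_entry:
  fixes f :: "real ^ 'n \<Rightarrow> real ^ 'm"
  assumes "f ` int_lattice \<subseteq> int_lattice"
  shows "matrix f $ i $ j \<in> \<int>"
proof -
  have "axis j 1 \<in> (int_lattice :: (real ^ 'n) set)"
    by (simp add: mem_int_lattice axis_def)
  then have "f (axis j 1) \<in> int_lattice" using assms by auto
  then show ?thesis by (simp add: matrix_def mem_int_lattice)
qed

text \<open>By Cramer's rule the coordinates of the preimage of a lattice point are quotients of
  integer determinants with denominator 1 or -1.\<close>

lemma linear_det_one_preimage:
  fixes f :: "real ^ 'n \<Rightarrow> real ^ 'n"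
  assumes "linear f" "f ` int_lattice \<subseteq> int_lattice" "\<bar>det (matrix f)\<bar> = 1"
  shows "f ` int_lattice = int_lattice"
proof -
  let ?A = "matrix f"
  have "y \<in> f ` int_lattice" if y: "y \<in> int_lattice" for y
  proof -
    define x :: "real ^ 'n" where "x = (\<chi> k. det (\<chi> i j. if j = k then y $ i else ?A $ i $ j) / det ?A)"
    have "det ?A \<noteq> 0" using assms(3) by auto
    from cramer[OF this, of x y] have "?A *v x = y" by (simp add: x_def)
    then have "f x = y" using assms(1) by (metis matrix_vector_mul(2))
    moreover have "x \<in> int_lattice"
    proof -
      have "det (\<chi> i j. if j = k then y $ i else ?A $ i $ j) \<in> \<int>" for k
        using y Ints_matrix_entry[OF assms(2)] by (intro det_Ints) (auto simp: mem_int_lattice)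
      moreover have "det ?A = 1 \<or> det ?A = - 1" using assms(3) by linarith
      ultimately show ?thesis by (auto simp: mem_int_lattice x_def)
    qed
    ultimately show ?thesis by blast
  qed
  then show ?thesis using assms(2) by blast
qed

text \<open>The inverse map also preserves the lattice, so both determinants are integers; their
  product is 1.\<close>

lemma linear_det_image_lattice:
  fixes f :: "real ^ 'n \<Rightarrow> real ^ 'n"
  assumes "linear f" "f ` int_lattice = int_lattice" "inj f"
  shows "\<bar>det (matrix f)\<bar> = 1"
proof -
  obtain g where g: "linear g" "g \<circ> f = id" using linear_injective_left_inverse[OF assms(1,3)] by blast
  have "g ` int_lattice = (g \<circ> f) ` int_lattice" by (metis assms(2) image_comp)
  then have gl: "g ` int_lattice \<subseteq> int_lattice" using g by simp
  have "det (matrix g) * det (matrix f) = 1"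
    using g assms(1) by (metis det_I det_mul matrix_compose matrix_id_mat_1)
  moreover have "det (matrix g) \<in> \<int>" "det (matrix f) \<in> \<int>"
    using gl assms by (auto intro!: det_Ints Ints_matrix_entry)
  ultimately obtain p q where pq: "det (matrix g) = of_int p" "det (matrix f) = of_int q"
    by (auto elim!: Ints_cases)
  then have "p * q = 1"
    using \<open>det (matrix g) * det (matrix f) = 1\<close> by (metis of_int_mult of_int_eq_1_iff)
  then have "q = 1 \<or> q = - 1" by (auto simp: zmult_eq_1_iff)
  then show ?thesis using pq by auto
qed

section \<open>Lebesgue measure under linear maps and relabelling of coordinates\<close>

text \<open>Lebesgue measure is determined by its values on boxes, and for a box the determinant
  formula for the volume of a linear image applies to its preimage. The form as a density of a
  push-forward transports integrals as well as volumes.\<close>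

lemma lborel_eq_density_distr_linear:
  fixes f :: "real ^ 'n :: {finite, wellorder} \<Rightarrow> real ^ 'n :: {finite, wellorder}"
  assumes "linear f" "inj f"
  shows "lborel = density (distr lborel borel f) (\<lambda>_. ennreal \<bar>det (matrix f)\<bar>)"
proof (rule lborel_eqI)
  have [measurable]: "f \<in> borel_measurable borel"
    using assms(1) by (intro borel_measurable_continuous_onI linear_continuous_on) (simp add: linear_linear)
  have surj: "surj f" using assms by (simp add: linear_inj_imp_surj)
  obtain g where g: "linear g" "g \<circ> f = id" "f \<circ> g = id"
    using linear_injective_isomorphism[OF assms] by (metis comp_def eq_id_iff)
  fix l u :: "real ^ 'n :: {finite, wellorder}"
  assume "\<And>b. b \<in> Basis \<Longrightarrow> l \<bullet> b \<le> u \<bullet> b"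
  \<comment> \<open>As the image of a box under the linear inverse, the preimage is bounded, hence
    of finite measure.\<close>
  have vim: "f -` box l u = g ` box l u"
  proof (intro equalityI subsetI)
    fix x assume "x \<in> f -` box l u"
    moreover have "x = g (f x)" using g(2) by (simp add: fun_eq_iff)
    ultimately show "x \<in> g ` box l u" by blast
  next
    fix x assume "x \<in> g ` box l u"
    then show "x \<in> f -` box l u" using g(3) by (auto simp: fun_eq_iff)
  qed
  have bd: "bounded (f -` box l u)"
    unfolding vim using g(1) by (intro bounded_linear_image) (auto simp: linear_linear)
  have bor: "f -` box l u \<in> sets borel"
    using measurable_sets_borel[of f borel "box l u"] by simp
  have "measure lborel (box l u) = measure lebesgue (f ` (f -` box l u))"
    using surj by (simp add: surj_image_vimage_eq)
  also have "\<dots> = \<bar>det (matrix f)\<bar> * measure lborel (f -` box l u)"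
    using bd bor assms(1) by (subst measure_lebesgue_linear_transformation) auto
  finally have "emeasure lborel (box l u) = ennreal \<bar>det (matrix f)\<bar> * emeasure lborel (f -` box l u)"
    using emeasure_eq_ennreal_measure[of lborel "box l u"] emeasure_eq_ennreal_measure[of lborel "f -` box l u"]
      emeasure_bounded_finite[OF bd] emeasure_bounded_finite[OF bounded_box[of l u]]
    by (simp add: ennreal_mult del: emeasure_lborel_box_eq measure_lborel_box_eq)
  then show "emeasure (density (distr lborel borel f) (\<lambda>_. ennreal \<bar>det (matrix f)\<bar>)) (box l u)
      = (\<Prod>b\<in>Basis. (u - l) \<bullet> b)"
    by (simp add: emeasure_density_const emeasure_distr emeasure_lborel_box_eq  \<open>\<And>b. b \<in> Basis \<Longrightarrow> l \<bullet> b \<le> u \<bullet> b\<close>)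
qed simp

definition to_wo :: "real ^ 'n \<Rightarrow> real ^ 'n wo" where
  "to_wo x = (\<chi> i. x $ Rep_wo i)"

definition of_wo :: "real ^ 'n wo \<Rightarrow> real ^ 'n" where
  "of_wo x = (\<chi> i. x $ Abs_wo i)"

lemma to_of_wo [simp]: "to_wo (of_wo x) = x" "of_wo (to_wo y) = y"
  by (simp_all add: to_wo_def of_wo_def vec_eq_iff Rep_wo_inverse Abs_wo_inverse)

lemma inj_to_wo: "inj to_wo" and inj_of_wo: "inj of_wo"
  by (metis injI to_of_wo)+

lemma linear_wo: "linear to_wo" "linear of_wo"
  by (auto simp: linear_iff to_wo_def of_wo_def vec_eq_iff)

lemma measurable_of_wo [measurable]: "of_wo \<in> borel_measurable borel"
  using linear_wo(2) by (auto intro!: borel_measurable_continuous_onI linear_continuous_on simp: linear_linear)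

lemma wo_int_lattice: "to_wo ` int_lattice = int_lattice" "of_wo ` int_lattice = int_lattice"
proof -
  have a: "to_wo x \<in> int_lattice \<longleftrightarrow> x \<in> int_lattice" for x :: "real ^ 'n"
    by (auto simp: to_wo_def mem_int_lattice) (metis Abs_wo_inverse UNIV_I)
  show "to_wo ` (int_lattice :: (real ^ 'n) set) = int_lattice"
  proof (intro equalityI subsetI)
    fix y :: "real ^ 'n wo"
    assume "y \<in> int_lattice"
    then have "of_wo y \<in> int_lattice" using a[of "of_wo y"] by simp
    then show "y \<in> to_wo ` int_lattice" by (metis image_eqI to_of_wo(1))
  qed (use a in auto)
  then show "of_wo ` int_lattice = (int_lattice :: (real ^ 'n) set)"
    by (force simp: image_iff)
qed

text \<open>Relabelling coordinates carries boxes to boxes and only permutes the factors in the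
  product of side lengths.\<close>

lemma distr_of_wo: "distr lborel borel of_wo = lborel"
proof (rule sym, rule lborel_eqI)
  fix l u :: "real ^ 'n"
  assume "\<And>b. b \<in> Basis \<Longrightarrow> l \<bullet> b \<le> u \<bullet> b"
  then have le: "l $ i \<le> u $ i" for i by (metis axis_in_Basis_iff cart_eq_inner_axis insertI1 Basis_real_def)
  have prod: "(\<Prod>b\<in>Basis. (y - x) \<bullet> b) = (\<Prod>i\<in>UNIV. y $ i - x $ i)" for x y :: "real ^ 'm"
  proof -
    have "(\<Prod>b\<in>Basis. (y - x) \<bullet> b) = (\<Prod>b\<in>range (\<lambda>i. axis i 1). (y - x) \<bullet> b)"
      by (simp only: Basis_eq_range_axis)
    also have "\<dots> = (\<Prod>i\<in>UNIV. (y - x) \<bullet> axis i 1)"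
      by (subst prod.reindex) (auto simp: inj_on_def axis_eq_axis)
    finally show ?thesis by (simp add: inner_axis)
  qed
  have "of_wo -` box l u = box (to_wo l) (to_wo u)"
    by (auto simp: mem_box_cart of_wo_def to_wo_def)
       (metis Abs_wo_inverse Rep_wo_inverse UNIV_I)+
  then have "emeasure (distr lborel borel of_wo) (box l u) = emeasure lborel (box (to_wo l) (to_wo u))"
    by (simp add: emeasure_distr)
  also have "\<dots> = (\<Prod>i\<in>UNIV. to_wo u $ i - to_wo l $ i)"
    unfolding prod[symmetric] using le
    by (intro emeasure_lborel_box) (auto simp: Basis_vec_def inner_axis to_wo_def)
  also have "(\<Prod>i\<in>UNIV. to_wo u $ i - to_wo l $ i) = (\<Prod>i\<in>UNIV. u $ i - l $ i)"
    unfolding to_wo_def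
    by (rule prod.reindex_bij_witness[of _ Abs_wo Rep_wo]) (auto simp: Rep_wo_inverse Abs_wo_inverse)
  finally show "emeasure (distr lborel borel of_wo) (box l u) = (\<Prod>b\<in>Basis. (u - l) \<bullet> b)"
    by (simp add: prod)
qed simp

text \<open>The number \<open>d\<close> is the absolute value of the determinant of \<open>f\<close>
  read in ordered coordinates: an integer because the matrix is integral, nonzero because
  \<open>f\<close> is injective. Translation invariance makes the same \<open>d\<close> serve for
  every \<open>b\<close>.\<close>

lemma lattice_map_volume:
  fixes f :: "real ^ 'n \<Rightarrow> real ^ 'n"
  assumes "linear f" "inj f" "f ` int_lattice \<subseteq> int_lattice"
  obtains d :: nat where "d \<ge> 1"
    and "\<And>b. lborel = density (distr lborel borel (\<lambda>x. f x + b)) (\<lambda>_. ennreal (real d))"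
    and "d = 1 \<longleftrightarrow> f ` int_lattice = int_lattice"
proof -
  define h where "h = to_wo \<circ> f \<circ> of_wo"
  have f_eq: "f = of_wo \<circ> h \<circ> to_wo" by (auto simp: h_def fun_eq_iff)
  have lin: "linear h" unfolding h_def by (intro linear_compose linear_wo assms)
  have inj: "inj h" using assms(2) unfolding h_def by (intro inj_compose inj_to_wo inj_of_wo)
  have lat: "h ` int_lattice = to_wo ` f ` int_lattice"
    by (simp only: h_def image_comp[symmetric] wo_int_lattice)
  have lat_sub: "h ` int_lattice \<subseteq> int_lattice" 
    unfolding lat using assms(3) wo_int_lattice(1) by (metis image_mono)
  have lat_eq: "h ` int_lattice = int_lattice \<longleftrightarrow> f ` int_lattice = int_lattice"
    unfolding lat by (metis wo_int_lattice(1) inj_image_eq_iff inj_to_wo)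
  have "det (matrix h) \<in> \<int>" by (intro det_Ints Ints_matrix_entry lat_sub)
  then obtain z where z: "det (matrix h) = of_int z" by (elim Ints_cases)
  define d where "d = nat \<bar>z\<bar>"
  have d: "\<bar>det (matrix h)\<bar> = real d" by (simp add: z d_def)
  have "det (matrix h) \<noteq> 0" using det_nz_iff_inj[OF lin] inj by simp
  then have "d \<ge> 1" using d by (cases d) auto
  have [measurable]: "f \<in> borel_measurable borel" "h \<in> borel_measurable borel"
    using assms(1) lin by (auto intro!: borel_measurable_continuous_onI linear_continuous_on simp: linear_linear)
  have "lborel = density (distr lborel borel (\<lambda>x. f x + b)) (\<lambda>_. ennreal (real d))" for b
  proof (rule measure_eqI)
    fix Y :: "(real ^ 'n) set" assume "Y \<in> sets lborel"
    then have [measurable]: "Y \<in> sets borel" by simp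
    \<comment> \<open>The translation is stripped off first; the rest of the chain passes to ordered
      coordinates, applies the linear case there, and passes back.\<close>
    define X where "X = (+) b -` Y"
    have [measurable]: "X \<in> sets borel"
      unfolding X_def using measurable_sets_borel[of "(+) b" borel Y] by simp
    have "emeasure lborel Y = emeasure lborel X"
      by (subst lborel_distr_plus[of b, symmetric]) (simp add: emeasure_distr X_def)
    also
    have "emeasure lborel X = emeasure lborel (of_wo -` X)"
      by (subst distr_of_wo[symmetric]) (simp add: emeasure_distr)
    also have "\<dots> = ennreal (real d) * emeasure lborel (h -` of_wo -` X)"
    proof (subst lborel_eq_density_distr_linear[OF lin inj])
      have "of_wo -` X \<in> sets borel" using measurable_sets_borel[of of_wo borel X] by simp
      then show "emeasure (density (distr lborel borel h) (\<lambda>_. ennreal \<bar>det (matrix h)\<bar>)) (of_wo -` X)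
        = ennreal (real d) * emeasure lborel (h -` of_wo -` X)"
        by (simp add: emeasure_density_const emeasure_distr d)
    qed
    also have "h -` of_wo -` X = of_wo -` f -` X" by (auto simp: h_def)
    also have "emeasure lborel \<dots> = emeasure lborel (f -` X)"
    proof (subst (2) distr_of_wo[symmetric])
      have "f -` X \<in> sets borel" using measurable_sets_borel[of f borel X] by simp
      then show "emeasure lborel (of_wo -` f -` X) = emeasure (distr lborel borel of_wo) (f -` X)"
        by (simp add: emeasure_distr)
    qed
    also have "f -` X = (\<lambda>x. f x + b) -` Y"
      by (auto simp: X_def add.commute)
    finally show "emeasure lborel Y = emeasure (density (distr lborel borel (\<lambda>x. f x + b)) (\<lambda>_. ennreal (real d))) Y"
      by (simp add: emeasure_density_const emeasure_distr)
  qed simp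
  moreover have "d = 1 \<longleftrightarrow> f ` int_lattice = int_lattice"
    using linear_det_one_preimage[OF lin lat_sub] linear_det_image_lattice[OF lin _ inj] lat_eq d by auto
  ultimately show ?thesis using that \<open>d \<ge> 1\<close> by blast
qed

section \<open>Volumes and integrals on scaled standard simplices\<close>

text \<open>This is the standard simplex scaled by \<open>c\<close>, for positive \<open>c\<close>.
  It is defined on every Euclidean space so that it also makes sense on
  \<open>'a \<times> real\<close>, one dimension higher.\<close>

definition corner_simplex :: "real \<Rightarrow> 'a::euclidean_space set" where
  "corner_simplex c = {x. (\<forall>b\<in>Basis. 0 \<le> x \<bullet> b) \<and> (\<Sum>b\<in>Basis. x \<bullet> b) \<le> c}"

lemma corner_simplex_eq_scaled:
  assumes "c > 0"
  shows "corner_simplex c = (\<lambda>x. c *\<^sub>R x) ` (convex hull (insert 0 Basis) :: 'a::euclidean_space set)"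
proof (intro equalityI subsetI)
  fix x :: 'a assume "x \<in> corner_simplex c"
  then have "(1 / c) *\<^sub>R x \<in> convex hull (insert 0 Basis)"
    using assms by (auto simp: std_simplex corner_simplex_def field_simps simp flip: sum_divide_distrib)
  moreover have "x = c *\<^sub>R ((1 / c) *\<^sub>R x)" using assms by simp
  ultimately show "x \<in> (\<lambda>x. c *\<^sub>R x) ` (convex hull (insert 0 Basis))" by (metis image_eqI)
next
  fix x :: 'a assume "x \<in> (\<lambda>x. c *\<^sub>R x) ` (convex hull (insert 0 Basis))"
  then show "x \<in> corner_simplex c"
    using assms mult_left_mono[of _ 1 c]
    by (auto simp: std_simplex corner_simplex_def simp flip: sum_distrib_left)
qed

lemma
  assumes "c > 0"
  shows compact_corner_simplex: "compact (corner_simplex c :: 'a::euclidean_space set)"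
    and convex_corner_simplex: "convex (corner_simplex c :: 'a::euclidean_space set)"
  unfolding corner_simplex_eq_scaled[OF assms]
  by (intro compact_scaling convex_scaling compact_convex_hull finite_imp_compact; simp)+

lemma measure_corner_simplex:
  assumes "c > 0"
  shows "measure lborel (corner_simplex c :: 'a::euclidean_space set) = c ^ DIM('a) / fact DIM('a)"
proof -
  have "measure lborel (corner_simplex c :: 'a set) = measure lebesgue (corner_simplex c :: 'a set)"
    using compact_corner_simplex[OF assms, where 'a = 'a] by (simp add: borel_compact)
  also have "\<dots> = c ^ DIM('a) * measure lebesgue (convex hull (insert 0 Basis) :: 'a set)"
    using measure_lebesgue_affine[of c 0 "convex hull (insert 0 Basis) :: 'a set"] assms
    by (simp add: corner_simplex_eq_scaled)
  also have "measure lebesgue (convex hull (insert 0 Basis) :: 'a set) = 1 / fact DIM('a)"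
    using content_std_simplex[where 'a = 'a]
    by (simp add: borel_compact compact_convex_hull finite_imp_compact)
  finally show ?thesis by simp
qed

lemma interior_corner_simplex:
  assumes "c > 0"
  shows "interior (corner_simplex c :: 'a::euclidean_space set) =
    {x. (\<forall>b\<in>Basis. 0 < x \<bullet> b) \<and> (\<Sum>b\<in>Basis. x \<bullet> b) < c}"
proof -
  have "interior (corner_simplex c :: 'a set) = (\<lambda>x. c *\<^sub>R x) ` interior (convex hull (insert 0 Basis))"
    unfolding corner_simplex_eq_scaled[OF assms] using assms
    by (intro interior_injective_linear_image) (auto simp: inj_on_def linear_scaleR)
  also have "\<dots> = {x. (\<forall>b\<in>Basis. 0 < x \<bullet> b) \<and> (\<Sum>b\<in>Basis. x \<bullet> b) < c}"
  proof (intro equalityI subsetI)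
    fix x :: 'a assume x: "x \<in> {x. (\<forall>b\<in>Basis. 0 < x \<bullet> b) \<and> (\<Sum>b\<in>Basis. x \<bullet> b) < c}"
    then have "(1 / c) *\<^sub>R x \<in> interior (convex hull (insert 0 Basis))"
      using assms by (auto simp: interior_std_simplex field_simps simp flip: sum_divide_distrib)
    moreover have "x = c *\<^sub>R ((1 / c) *\<^sub>R x)" using assms by simp
    ultimately show "x \<in> (\<lambda>x. c *\<^sub>R x) ` interior (convex hull (insert 0 Basis))" by (metis image_eqI)
  next
    fix x :: 'a assume "x \<in> (\<lambda>x. c *\<^sub>R x) ` interior (convex hull (insert 0 Basis))"
    then show "x \<in> {x. (\<forall>b\<in>Basis. 0 < x \<bullet> b) \<and> (\<Sum>b\<in>Basis. x \<bullet> b) < c}"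
      using assms mult_strict_left_mono[of _ 1 c]
      by (auto simp: interior_std_simplex simp flip: sum_distrib_left)
  qed
  finally show ?thesis .
qed

text \<open>The simplex one dimension higher is the region between the base simplex and the graph of
  \<open>c\<close> minus the coordinate sum.\<close>

lemma corner_simplex_prod_iff:
  "(x, t) \<in> corner_simplex c \<longleftrightarrow> x \<in> corner_simplex c \<and> 0 \<le> t \<and> t \<le> c - (\<Sum>b\<in>Basis. x \<bullet> b)"
  for x :: "'a::euclidean_space" and t :: real
proof -
  have "(\<Sum>b\<in>Basis. (x, t) \<bullet> b) = (\<Sum>b\<in>Basis. x \<bullet> b) + t"
  proof -
    have "(\<Sum>b\<in>Basis. (x, t) \<bullet> b) = (\<Sum>b\<in>(\<lambda>u. (u, 0)) ` (Basis :: 'a set). (x, t) \<bullet> b) + (\<Sum>b\<in>{(0, 1)}. (x, t) \<bullet> b)"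
      unfolding Basis_prod_def by (subst sum.union_disjoint[symmetric]) (auto simp: Basis_real_def)
    then show ?thesis by (simp add: sum.reindex inj_on_def)
  qed
  then show ?thesis by (auto simp: corner_simplex_def Basis_prod_def)
qed

text \<open>By Fubini the integral of the height function \<open>F\<close> is the volume of the
  region below its graph over the simplex, which is the simplex of dimension
  \<open>Suc DIM('a)\<close>.\<close>

lemma integral_corner_simplex:
  fixes c :: real
  assumes c: "c > 0"
  defines "F \<equiv> \<lambda>x :: 'a::euclidean_space. indicator (corner_simplex c) x * (c - (\<Sum>b\<in>Basis. x \<bullet> b))"
  shows "integrable lborel F" "integral\<^sup>L lborel F = c ^ Suc DIM('a) / fact (Suc DIM('a))"
proof -
  let ?S = "corner_simplex c :: ('a \<times> real) set"
  have [measurable]: "(corner_simplex c :: 'a set) \<in> sets borel"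
    using compact_corner_simplex[OF c] by (rule borel_compact)
  have S: "?S \<in> sets (lborel \<Otimes>\<^sub>M lborel)"
    unfolding lborel_prod sets_lborel using compact_corner_simplex[OF c] by (rule borel_compact)
  have meas: "F \<in> borel_measurable lborel" unfolding F_def by measurable
  have nonneg: "0 \<le> F x" for x
    by (auto simp: F_def indicator_def corner_simplex_def)
  have slice: "Pair x -` ?S = (if x \<in> corner_simplex c then {0..c - (\<Sum>b\<in>Basis. x \<bullet> b)} else {})" for x
    by (auto simp: corner_simplex_prod_iff)
  have "emeasure lborel ?S = emeasure (lborel \<Otimes>\<^sub>M lborel) ?S" by (simp add: lborel_prod)
  also have "\<dots> = (\<integral>\<^sup>+ x. emeasure lborel (Pair x -` ?S) \<partial>lborel)"
    by (rule lborel.emeasure_pair_measure_alt[OF S])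
  also have "\<dots> = (\<integral>\<^sup>+ x. ennreal (F x) \<partial>lborel)"
    by (intro nn_integral_cong) (auto simp: slice F_def, auto simp: corner_simplex_def)
  finally have "(\<integral>\<^sup>+ x. ennreal (F x) \<partial>lborel) = emeasure lborel ?S" ..
  also have "\<dots> = ennreal (measure lborel ?S)"
    using emeasure_bounded_finite[OF compact_imp_bounded[OF compact_corner_simplex[OF c]], where 'a = "'a \<times> real"]
    by (simp add: emeasure_eq_ennreal_measure)
  also have "measure lborel ?S = c ^ Suc DIM('a) / fact (Suc DIM('a))"
    using measure_corner_simplex[OF c, where 'a = "'a \<times> real"] by simp
  finally have "has_bochner_integral lborel F (c ^ Suc DIM('a) / fact (Suc DIM('a)))"
    using c nonneg meas by (intro has_bochner_integral_nn_integral) auto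
  then show "integrable lborel F" "integral\<^sup>L lborel F = c ^ Suc DIM('a) / fact (Suc DIM('a))"
    by (auto simp: has_bochner_integral_iff)
qed

section \<open>The volume bound for convex bodies in the positive orthant\<close>

text \<open>Nonempty open sets are not null sets. This turns equality almost everywhere into
  inclusions of sets.\<close>

lemma AE_lborel_not_open:
  assumes "AE x in lborel. x \<notin> U" "open U"
  shows "U = {}"
proof (rule ccontr)
  assume "U \<noteq> {}"
  have "U \<in> null_sets lborel" using assms by (subst (asm) AE_iff_null) auto
  then show False
    using open_not_negligible[OF assms(2) \<open>U \<noteq> {}\<close>]
    by (simp add: negligible_iff_null_sets null_sets_completionI)
qed

text \<open>The hypothesis \<open>bary\<close> states that all barycenter coordinates equal 1, with
  the division by the volume cleared. The integrals of \<open>W\<close> over \<open>C\<close> and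
  over the simplex are compared; if they agree, \<open>C\<close> and the simplex can differ only in
  a null set where \<open>W\<close> is nonzero, which determines a convex body.\<close>

lemma orthant_barycenter_volume:
  fixes C :: "'a::euclidean_space set"
  assumes C: "compact C" "convex C" and orth: "\<And>x b. x \<in> C \<Longrightarrow> b \<in> Basis \<Longrightarrow> 0 \<le> x \<bullet> b"
    and bary: "\<And>b. b \<in> Basis \<Longrightarrow> (\<integral>x. indicator C x * (x \<bullet> b) \<partial>lborel) = measure lborel C"
  defines "n \<equiv> DIM('a)"
  shows "measure lborel C \<le> (real n + 1) ^ n / fact n"
    and "measure lborel C = (real n + 1) ^ n / fact n \<Longrightarrow> C = corner_simplex (real n + 1)"
proof -
  \<comment> \<open>With this value the integral of \<open>W\<close> over \<open>C\<close> is
    \<open>c - n = 1\<close> times the volume of \<open>C\<close>.\<close>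
  define c where "c = real n + 1"
  have c: "c > 0" by (simp add: c_def)
  let ?S = "corner_simplex c :: 'a set"
  define W where "W x = c - (\<Sum>b\<in>Basis. x \<bullet> b)" for x :: 'a
  have int1: "integrable lborel (indicator C :: 'a \<Rightarrow> real)"
    using C by (intro integrable_real_indicator emeasure_bounded_finite) (simp_all add: borel_compact compact_imp_bounded)
  have intb: "integrable lborel (\<lambda>x. indicator C x * (x \<bullet> b))" for b
    using borel_integrable_compact[of C "\<lambda>x. x \<bullet> b"] C
    by (auto simp: continuous_intros indicator_def if_distrib if_distribR cong: if_cong)
  have W_eq: "indicator C x * W x = c * indicator C x - (\<Sum>b\<in>Basis. indicator C x * (x \<bullet> b))" for x
    by (simp add: W_def algebra_simps sum_distrib_left)
  have intC: "integrable lborel (\<lambda>x. indicator C x * W x)"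
    unfolding W_eq using int1 intb by (intro Bochner_Integration.integrable_diff Bochner_Integration.integrable_sum) auto
  have "(\<integral>x. (\<Sum>b\<in>Basis. indicator C x * (x \<bullet> b)) \<partial>lborel) = (\<Sum>b\<in>Basis. \<integral>x. indicator C x * (x \<bullet> b) \<partial>lborel)"
    by (rule Bochner_Integration.integral_sum) (rule intb)
  also have "\<dots> = n * measure lborel C" using bary by (simp add: n_def)
  finally have sum: "(\<integral>x. (\<Sum>b\<in>Basis. indicator C x * (x \<bullet> b)) \<partial>lborel) = n * measure lborel C" .
  have valC: "(\<integral>x. indicator C x * W x \<partial>lborel) = measure lborel C"
    unfolding W_eq Bochner_Integration.integral_diff[OF integrable_mult_right[OF int1] Bochner_Integration.integrable_sum[OF intb]] sum
    by (simp, simp add: c_def algebra_simps)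
  have intS: "integrable lborel (\<lambda>x. indicator ?S x * W x)"
    and valS: "(\<integral>x. indicator ?S x * W x \<partial>lborel) = (real n + 1) ^ n / fact n"
  proof -
    \<comment> \<open>Since \<open>c\<close> is also the new factor of the factorial, one power of
      \<open>c\<close> cancels.\<close>
    have "fact (Suc n) = c * fact n" by (simp add: c_def algebra_simps)
    then have "c ^ Suc n / fact (Suc n) = c ^ n / fact n" using c by simp
    then show "integrable lborel (\<lambda>x. indicator ?S x * W x)"
      "(\<integral>x. indicator ?S x * W x \<partial>lborel) = (real n + 1) ^ n / fact n"
      using integral_corner_simplex[OF c, where 'a = 'a] by (simp_all only: W_def c_def n_def)
  qed
  have in_S: "x \<in> ?S \<longleftrightarrow> 0 \<le> W x" if "x \<in> C" for x
    using orth[OF that] by (auto simp: corner_simplex_def W_def)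
  have W_S: "0 \<le> W x" if "x \<in> ?S" for x using that by (auto simp: corner_simplex_def W_def)
  \<comment> \<open>On \<open>C\<close> outside the simplex \<open>W\<close> is negative while the
    right side is 0; on the simplex outside \<open>C\<close> the left side is 0 while
    \<open>W\<close> is nonnegative.\<close>
  have le: "indicator C x * W x \<le> indicator ?S x * W x" for x
    using in_S W_S by (auto simp: indicator_def)
  show "measure lborel C \<le> (real n + 1) ^ n / fact n"
    using integral_mono[OF intC intS le] valC valS by simp
  show "C = corner_simplex (real n + 1)" if eq: "measure lborel C = (real n + 1) ^ n / fact n"
  proof -
    \<comment> \<open>Equality gives \<open>C\<close> positive volume, so \<open>C\<close> will be
      the closure of its interior.\<close>
    have ne: "interior C \<noteq> {}"
    proof
      assume "interior C = {}"
      then have "measure lebesgue C = 0"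
        using C(2) by (simp add: negligible_convex_interior negligible_imp_measure0)
      then show False using eq C by (simp add: borel_compact)
    qed
    have "(\<integral>x. indicator ?S x * W x - indicator C x * W x \<partial>lborel) = 0"
      using intS intC valS valC eq by simp
    then have ae: "AE x in lborel. indicator ?S x * W x - indicator C x * W x = 0"
      using intS intC le by (subst (asm) integral_nonneg_eq_0_iff_AE) auto
    have "interior ?S - C = {}"
    proof (rule AE_lborel_not_open)
      show "AE x in lborel. x \<notin> interior ?S - C"
        using ae
      proof eventually_elim
        case (elim x)
        show ?case
        proof
          assume x: "x \<in> interior ?S - C"
          then have "x \<in> ?S" using interior_subset by blast
          \<comment> \<open>\<open>W\<close> vanishes on a facet of the simplex, so the strict
            inequality is available only in the interior.\<close>
          moreover have "W x > 0" using x by (auto simp: interior_corner_simplex[OF c] W_def)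
          ultimately show False using elim x by simp
        qed
      qed
      show "open (interior ?S - C)" using C by (intro open_Diff) (auto intro: compact_imp_closed)
    qed
    moreover have "interior C - ?S = {}"
    proof (rule AE_lborel_not_open)
      show "AE x in lborel. x \<notin> interior C - ?S"
        using ae
      proof eventually_elim
        case (elim x)
        show ?case
        proof
          assume x: "x \<in> interior C - ?S"
          then have "x \<in> C" using interior_subset by blast
          then show False using elim x in_S[of x] by auto
        qed
      qed
      show "open (interior C - ?S)"
        using compact_corner_simplex[OF c] by (intro open_Diff) (auto intro: compact_imp_closed)
    qed
    moreover have "interior ?S \<noteq> {}"
    proof -
      obtain a :: 'a where "a \<in> interior (convex hull (insert 0 Basis))" by (rule interior_std_simplex_nonempty)
      then have "a \<in> interior ?S" unfolding interior_std_simplex interior_corner_simplex[OF c] by (auto simp: c_def)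
      then show ?thesis by blast
    qed
    \<comment> \<open>Both sets are closed and convex with nonempty interior, hence closures of
      their interiors; the inclusions of interiors pass to the sets.\<close>
    ultimately have "closure (interior ?S) \<subseteq> C" "closure (interior C) \<subseteq> ?S"
      using C(1) compact_corner_simplex[OF c] by (meson closure_minimal compact_imp_closed Diff_eq_empty_iff)+
    then have "?S = C"
      using convex_closure_interior[OF C(2) ne] convex_closure_interior[OF convex_corner_simplex[OF c] \<open>interior ?S \<noteq> {}\<close>]
        closure_closed[OF compact_imp_closed[OF C(1)]] closure_closed[OF compact_imp_closed[OF compact_corner_simplex[OF c]]]
      by auto
    then show ?thesis by (simp add: c_def add.commute)
  qed
qed

section \<open>Transport of volumes and barycenters to affine images\<close>

lemma affine_image_integral:
  fixes f :: "'a::euclidean_space \<Rightarrow> 'a" and g :: "'a \<Rightarrow> real"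
  assumes f: "lborel = density (distr lborel borel f) (\<lambda>_. ennreal (real d))"
    and [measurable]: "f \<in> borel_measurable borel" "g \<in> borel_measurable borel"
  shows "(\<integral>y. g y \<partial>lborel) = d * (\<integral>x. g (f x) \<partial>lborel)"
  by (subst f) (simp add: integral_density integral_distr)

lemma measure_affine_image:
  fixes f :: "'a::euclidean_space \<Rightarrow> 'a"
  assumes "lborel = density (distr lborel borel f) (\<lambda>_. ennreal (real d))"
    and "f \<in> borel_measurable borel" "inj f" "K \<in> sets borel" "f ` K \<in> sets borel"
  shows "measure lborel (f ` K) = d * measure lborel K"
proof -
  have "measure lborel (f ` K) = (\<integral>y. indicator (f ` K) y \<partial>lborel)"
    by simp
  also have "\<dots> = d * (\<integral>x. indicator (f ` K) (f x) \<partial>lborel)"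
    using assms by (intro affine_image_integral) auto
  also have "(\<lambda>x. indicator (f ` K) (f x)) = (indicator K :: 'a \<Rightarrow> real)"
    using assms(3) by (auto simp: indicator_def inj_image_mem_iff fun_eq_iff)
  finally show ?thesis by simp
qed

text \<open>The nonzero volume lets the normalising factor in \<open>barycenter\<close> be
  cancelled; the inner product with \<open>v\<close> then moves inside the vanishing
  integral.\<close>

lemma integral_indicator_inner_eq_0:
  fixes K :: "(real ^ 'n) set"
  assumes "compact K" "barycenter K = 0" "measure lebesgue K \<noteq> 0"
  shows "(\<integral>x. indicator K x * (v \<bullet> x) \<partial>lborel) = 0"
proof -
  have int: "integrable lborel (\<lambda>x. indicator K x *\<^sub>R x)"
    by (rule borel_integrable_compact[OF assms(1) continuous_on_id])
  have "(LINT x:K|lebesgue. x) = 0" using assms by (simp add: barycenter_def)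
  then have "(\<integral>x. indicator K x *\<^sub>R x \<partial>lborel) = 0"
    using int by (simp add: set_lebesgue_integral_def integral_completion borel_measurable_integrable)
  moreover have "(\<integral>x. indicator K x * (v \<bullet> x) \<partial>lborel) = v \<bullet> (\<integral>x. indicator K x *\<^sub>R x \<partial>lborel)"
    using integral_inner_right[of v lborel "\<lambda>x. indicator K x *\<^sub>R x"] int by simp
  ultimately show ?thesis by simp
qed

section \<open>Bases of vertices and affine lattice automorphisms\<close>

text \<open>A polytope lies in the span of its vertices, and a proper subspace has empty interior.
  So the vertices span the space, and a basis chosen among them can be indexed by the
  coordinates.\<close>

lemma polytope_vertex_basis:
  fixes Q :: "(real ^ 'n) set"
  assumes "polytope Q" "interior Q \<noteq> {}"
  obtains v :: "'n \<Rightarrow> real ^ 'n" where "\<And>i. v i extreme_point_of Q" "span (range v) = UNIV"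
proof -
  define E where "E = {x. x extreme_point_of Q}"
  have "Q = convex hull E"
    unfolding E_def using assms(1) by (intro Krein_Milman_Minkowski polytope_imp_compact polytope_imp_convex)
  then have "interior Q \<subseteq> interior (span E)"
    by (metis convex_hull_subset_span interior_mono)
  then have "\<not> dim (span E) < DIM(real ^ 'n)"
    using empty_interior_lowdim[of "span E"] assms(2) by blast
  then have dimE: "dim E = CARD('n)"
    using dim_subset_UNIV[of E] by simp
  then have spanE: "span E = UNIV" using dim_eq_full[of E] by simp
  obtain B where B: "B \<subseteq> E" "independent B" "E \<subseteq> span B" "card B = dim E"
    using basis_exists[of E] by blast
  have "finite B" using B(2) by (rule independent_imp_finite)
  then obtain v where v: "bij_betw v (UNIV :: 'n set) B"
    using finite_same_card_bij[of "UNIV :: 'n set" B] B(4) dimE by auto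
  then have "range v = B" by (simp add: bij_betw_def)
  moreover have "span B = UNIV" using B(3) spanE by (metis span_span span_mono UNIV_I subsetI subset_antisym)
  ultimately show ?thesis
    using that[of v] B(1) by (auto simp: E_def)
qed

lemma Ints_inner_int_lattice:
  assumes "x \<in> int_lattice" "y \<in> int_lattice"
  shows "x \<bullet> y \<in> \<int>"
  using assms by (auto simp: inner_vec_def mem_int_lattice intro!: Ints_sum Ints_mult)

lemma unit_simplex_eq: "unit_simplex = convex hull (insert 0 (Basis :: (real ^ 'n) set))"
  by (simp only: unit_simplex_def Basis_eq_range_axis)

text \<open>The translation \<open>b\<close> is the image of 0, hence a lattice point, and can be
  subtracted. The range of \<open>g\<close> then contains the standard basis, so \<open>g\<close> is
  surjective and therefore injective.\<close>

lemma lattice_automorphism_linear_part: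
  fixes g :: "real ^ 'n \<Rightarrow> real ^ 'n"
  assumes g: "linear g" and bij: "bij_betw (\<lambda>x. g x + b) int_lattice int_lattice"
  shows "g ` int_lattice = int_lattice" "inj g"
proof -
  have 0: "0 \<in> (int_lattice :: (real ^ 'n) set)" by (simp add: mem_int_lattice)
  have add: "x + y \<in> int_lattice" "x - y \<in> int_lattice" if "x \<in> int_lattice" "y \<in> int_lattice" for x y :: "real ^ 'n"
    using that by (auto simp: mem_int_lattice)
  have im: "(\<lambda>x. g x + b) ` int_lattice = int_lattice" using bij by (rule bij_betw_imp_surj_on)
  have b: "b \<in> int_lattice" using im 0 linear_0[OF g] by (metis (no_types, lifting) add_0 image_eqI)
  show lat: "g ` int_lattice = int_lattice"
  proof (intro equalityI subsetI)
    fix y assume "y \<in> g ` int_lattice"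
    then obtain x where "x \<in> int_lattice" "y = g x" by blast
    then have "y + b \<in> int_lattice" using im by blast
    then show "y \<in> int_lattice" using add(2)[OF _ b] by fastforce
  next
    fix y :: "real ^ 'n" assume "y \<in> int_lattice"
    then have "y + b \<in> (\<lambda>x. g x + b) ` int_lattice" using im add(1) b by blast
    then show "y \<in> g ` int_lattice" by auto
  qed
  have "Basis \<subseteq> range g"
  proof
    fix y :: "real ^ 'n" assume "y \<in> Basis"
    then have "y \<in> int_lattice" by (auto simp: Basis_vec_def mem_int_lattice axis_def)
    then show "y \<in> range g" using lat by blast
  qed
  then have "span Basis \<subseteq> range g"
    using g by (intro span_minimal linear_subspace_image) auto
  then have "surj g" by auto
  then show "inj g" using g by (simp add: linear_surj_imp_inj)
qed

text \<open>The linear part maps the lattice onto itself, so its volume factor is 1. This gives the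
  converse direction of the equality case.\<close>

lemma measure_lebesgue_lattice_automorphism:
  fixes K :: "(real ^ 'n) set"
  assumes "affine_lattice_automorphism f" "compact K"
  shows "measure lebesgue (f ` K) = measure lebesgue K"
proof -
  obtain g b where g: "linear g" and f: "f = (\<lambda>x. g x + b)" and bij: "bij_betw f int_lattice int_lattice"
    using assms(1) by (auto simp: affine_lattice_automorphism_def)
  note gl = lattice_automorphism_linear_part[OF g bij[unfolded f]]
  obtain d where "lborel = density (distr lborel borel (\<lambda>x. g x + b)) (\<lambda>_. ennreal (real d))" "d = 1"
    using lattice_map_volume[OF g gl(2)] gl(1) by (metis order_refl)
  then have "lborel = density (distr lborel borel f) (\<lambda>_. ennreal (real 1))" by (simp add: f)
  moreover have cont: "continuous_on A f" for A
    unfolding f using g by (intro continuous_intros linear_continuous_on) (simp add: linear_linear)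
  moreover have "inj f" using gl(2) by (auto simp: f inj_on_def)
  ultimately have "measure lborel (f ` K) = real 1 * measure lborel K"
    using assms(2) by (intro measure_affine_image)
      (auto intro: borel_compact compact_continuous_image borel_measurable_continuous_onI)
  moreover have "compact (f ` K)" using cont assms(2) by (rule compact_continuous_image)
  ultimately show ?thesis using assms(2) by (simp add: borel_compact)
qed

section \<open>Reduction of the dual polytope setting to the orthant\<close>

theorem theorem1p4:
  fixes Q K :: "(real ^ 'n) set"
  assumes "lattice_polytope Q"
    and "0 \<in> interior Q"
    and "convex_body K"
    and "aff_dim K = int CARD('n)"
    and "barycenter K = 0"
    and "K \<subseteq> dual_polytope Q"
    and "interior K \<inter> int_lattice = {0}"
  shows "measure lebesgue K \<le> (real CARD('n) + 1) ^ CARD('n) / fact CARD('n) \<and>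
    (measure lebesgue K = (real CARD('n) + 1) ^ CARD('n) / fact CARD('n) \<longleftrightarrow>
           unimodularly_equivalent K ((\<lambda>x. (real CARD('n) + 1) *\<^sub>R x) ` unit_simplex))"
proof -
  define M where "M = (real CARD('n) + 1) ^ CARD('n) / fact CARD('n)"
  have "M > 0" by (simp add: M_def)
  let ?S = "(\<lambda>x. (real CARD('n) + 1) *\<^sub>R x) ` unit_simplex :: (real ^ 'n) set"
  have S: "?S = corner_simplex (real CARD('n) + 1)"
    by (simp add: corner_simplex_eq_scaled unit_simplex_eq)
  have K: "compact K" "convex K" using assms(3) by (auto simp: convex_body_def)
  have Kborel: "K \<in> sets borel" using K(1) by (rule borel_compact)
  \<comment> \<open>The origin is an interior point, so \<open>K\<close> has positive volume and the
    division in \<open>barycenter\<close> is a genuine one.\<close>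
  have "interior K \<noteq> {}" using assms(7) by blast
  then have "\<not> negligible K" by (simp add: negligible_convex_interior K(2))
  then have Kpos: "measure lebesgue K \<noteq> 0"
    using K(1) by (simp add: negligible_iff_measure lmeasurable_compact)
  obtain v :: "'n \<Rightarrow> real ^ 'n" where v: "\<And>i. v i extreme_point_of Q" "span (range v) = UNIV"
    using polytope_vertex_basis[of Q] assms(1,2) by (auto simp: lattice_polytope_def)
  have v_lat: "v i \<in> int_lattice" for i using v(1) assms(1) by (auto simp: lattice_polytope_def)
  define T :: "real ^ 'n \<Rightarrow> real ^ 'n" where "T x = (\<chi> i. v i \<bullet> x)" for x
  have lin: "linear T" by (auto simp: linear_iff T_def vec_eq_iff inner_add_right)
  have inj: "inj T"
    unfolding linear_injective_0[OF lin]
  proof (intro allI impI)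
    fix x assume "T x = 0"
    \<comment> \<open>A vector in the kernel is orthogonal to every \<open>v i\<close>, hence to
      their span, which is the whole space and contains the vector itself.\<close>
    then have "orthogonal x y" if "y \<in> range v" for y
      using that by (auto simp: T_def vec_eq_iff orthogonal_def inner_commute)
    then have "orthogonal x x" using v(2) by (intro orthogonal_to_span[of x "range v"]) auto
    then show "x = 0" by (simp add: orthogonal_self)
  qed
  have lat: "T ` int_lattice \<subseteq> int_lattice"
    using Ints_inner_int_lattice[OF v_lat] by (auto simp: T_def mem_int_lattice[of "vec_lambda _"])
  \<comment> \<open>The shift by 1 turns the inequalities \<open>v i \<bullet> x \<ge> - 1\<close>
    of the dual polytope into nonnegativity of coordinates and moves the barycenter from 0 to
    \<open>b\<close>.\<close>
  define b :: "real ^ 'n" where "b = (\<chi> i. 1)"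
  define f where "f x = T x + b" for x
  obtain d where d: "d \<ge> 1" "lborel = density (distr lborel borel f) (\<lambda>_. ennreal (real d))"
      "d = 1 \<longleftrightarrow> T ` int_lattice = int_lattice"
    using lattice_map_volume[OF lin inj lat] unfolding f_def by metis
  have cont: "continuous_on A f" for A
    unfolding f_def using lin by (intro continuous_intros linear_continuous_on) (simp add: linear_linear)
  then have fm: "f \<in> borel_measurable borel" by (intro borel_measurable_continuous_onI)
  have injf: "inj f" using inj by (auto simp: f_def inj_on_def)
  have C: "compact (f ` K)" using cont K(1) by (rule compact_continuous_image)
  have Cborel: "f ` K \<in> sets borel" using C by (rule borel_compact)
  have f_eq: "f = (\<lambda>x. x + b) \<circ> T" by (simp add: f_def fun_eq_iff)
  then have "f ` K = (\<lambda>x. x + b) ` T ` K" by (simp add: image_comp)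
  then have Cconv: "convex (f ` K)"
    using convex_linear_image[OF lin K(2)] convex_translation[of "T ` K" b] by (simp add: add.commute)
  have vol: "measure lborel (f ` K) = d * measure lborel K"
    using d(2) fm injf Kborel Cborel by (rule measure_affine_image)
  have inner_f: "f x \<bullet> axis i 1 = v i \<bullet> x + 1" for x i
    by (simp add: f_def T_def b_def inner_axis)
  have orth: "0 \<le> y \<bullet> e" if "y \<in> f ` K" "e \<in> Basis" for y e
  proof -
    obtain x where "x \<in> K" "y = f x" using \<open>y \<in> f ` K\<close> by blast
    moreover obtain i where "e = axis i 1" using \<open>e \<in> Basis\<close> unfolding Basis_eq_range_axis by blast
    moreover have "v i \<bullet> x \<ge> - 1" using assms(6) \<open>x \<in> K\<close> v(1) by (auto simp: dual_polytope_def)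
    ultimately show ?thesis by (simp add: inner_f)
  qed
  have bary: "(\<integral>y. indicator (f ` K) y * (y \<bullet> e) \<partial>lborel) = measure lborel (f ` K)" if "e \<in> Basis" for e
  proof -
    obtain i where e: "e = axis i 1" using \<open>e \<in> Basis\<close> unfolding Basis_eq_range_axis by blast
    have int: "integrable lborel (\<lambda>x. indicator K x * (v i \<bullet> x))" "integrable lborel (indicator K :: _ \<Rightarrow> real)"
      using borel_integrable_compact[OF K(1), of "\<lambda>x. v i \<bullet> x"] borel_integrable_compact[OF K(1), of "\<lambda>x. 1 :: real"]
      by (simp_all add: continuous_intros)
    have "(\<integral>y. indicator (f ` K) y * (y \<bullet> e) \<partial>lborel) = d * (\<integral>x. indicator (f ` K) (f x) * (f x \<bullet> e) \<partial>lborel)"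
      using fm Cborel by (intro affine_image_integral d) auto
    also have "(\<lambda>x. indicator (f ` K) (f x) * (f x \<bullet> e)) = (\<lambda>x. indicator K x * (v i \<bullet> x) + indicator K x)"
      using injf by (auto simp: e inner_f indicator_def inj_image_mem_iff fun_eq_iff)
    also have "(\<integral>x. indicator K x * (v i \<bullet> x) + indicator K x \<partial>lborel) = measure lborel K"
      unfolding Bochner_Integration.integral_add[OF int] integral_indicator_inner_eq_0[OF K(1) assms(5) Kpos] by simp
    finally show ?thesis by (simp add: vol)
  qed
  have volK: "measure lebesgue K = measure lborel K" using Kborel by simp
  have le: "d * measure lebesgue K \<le> M"
    using orthant_barycenter_volume(1)[OF C Cconv orth bary] by (simp add: vol volK M_def add.commute)
  have "measure lebesgue K \<le> d * measure lebesgue K"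
    using d(1) by (simp add: mult_le_cancel_right1 measure_nonneg)
  with le have "measure lebesgue K \<le> M" by linarith
  moreover have "unimodularly_equivalent K ?S" if eq: "measure lebesgue K = M"
  proof -
    have "real d * M \<le> 1 * M" using le eq by simp
    then have "d = 1" using \<open>M > 0\<close> d(1) by simp
    then have "f ` K = ?S"
      using orthant_barycenter_volume(2)[OF C Cconv orth bary] eq vol volK
      unfolding S by (simp add: M_def add.commute)
    moreover have "affine_lattice_automorphism f"
      unfolding affine_lattice_automorphism_def
    proof (intro conjI exI)
      show "linear T" by (rule lin)
      show "f = (\<lambda>x. T x + b)" by (simp add: f_def fun_eq_iff)
      \<comment> \<open>The translation preserves the lattice because \<open>b\<close> has integer
        coordinates; the linear part does so because \<open>d = 1\<close>.\<close>
      have "(\<lambda>x. x + b) ` int_lattice = int_lattice"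
      proof (intro equalityI subsetI)
        fix y :: "real ^ 'n" assume "y \<in> int_lattice"
        then have "y - b \<in> int_lattice" by (auto simp: mem_int_lattice b_def)
        then show "y \<in> (\<lambda>x. x + b) ` int_lattice" by (metis diff_add_cancel image_eqI)
      qed (auto simp: mem_int_lattice b_def)
      moreover have "T ` int_lattice = int_lattice" using d(3) \<open>d = 1\<close> by simp
      ultimately have "f ` int_lattice = int_lattice" by (simp only: f_eq image_comp[symmetric])
      then show "bij_betw f int_lattice int_lattice"
        using injf by (simp add: bij_betw_def inj_on_subset[of f UNIV])
    qed
    ultimately show ?thesis by (auto simp: unimodularly_equivalent_def)
  qed
  moreover have "measure lebesgue K = M" if "unimodularly_equivalent K ?S"
  proof -
    obtain h where "affine_lattice_automorphism h" "h ` K = ?S"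
      using \<open>unimodularly_equivalent K ?S\<close> by (auto simp: unimodularly_equivalent_def)
    then have "measure lebesgue K = measure lebesgue ?S"
      using measure_lebesgue_lattice_automorphism[OF _ K(1)] by metis
    also have "\<dots> = measure lborel (corner_simplex (real CARD('n) + 1) :: (real ^ 'n) set)"
      using compact_corner_simplex[of "real CARD('n) + 1", where 'a = "real ^ 'n"] unfolding S by (simp add: borel_compact)
    also have "\<dots> = M" by (simp add: measure_corner_simplex M_def)
    finally show ?thesis .
  qed
  ultimately show ?thesis by (auto simp: M_def)
qed

end
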